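(* Let $p,q$ be relatively prime integers with $p>q\geq 1$ and let $M=\frac{p}{q}$. For each integer $m$ with $1\leq m\leq p-q$, let $\psi^m\in L^2(\mathbb{R})$ be Auscher's rational Littlewood-Paley wavelet, defined by $$\hat{\psi}^m(M\omega)=\begin{cases}1 & \text{if } (q+m-1)\frac{\pi}{p}\leq|\omega|<(q+m)\frac{\pi}{p},\\ 0 & \text{elsewhere,}\end{cases}$$ and let $\psi_{j,n}^m(x)=M^{-\frac{j}{2}}\psi^m(M^{-j}x-nq)$ for $j,n\in\mathbb{Z}$. If $q\neq 1$, then the family $\{\psi_{j,n}^m\}_{j,n\in\mathbb{Z},\ 1\leq m\leq p-q}$ is not orthonormal in $L^2(\mathbb{R})$.
   Context: $L^2(\mathbb{R})$ carries the inner product $\langle f,g\rangle=\int_{-\infty}^{+\infty}f(x)\overline{g(x)}\,dx$. The Fourier transform is $\hat{f}(\omega)=\int_{-\infty}^{+\infty}f(x)e^{-i\omega x}\,dx$ (extended to $L^2(\mathbb{R})$), so that Parseval's formula reads $\langle f,g\rangle=\frac{1}{2\pi}\langle\hat f,\hat g\rangle$. *)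

theory Defs
  imports "HOL-Analysis.Analysis"
begin

text \<open>
  Elements of \<open>L\<^sup>2(\<real>)\<close> are represented by Borel functions; every class modulo
  null sets has such a representative.
\<close>

definition square_integrable :: "(real \<Rightarrow> complex) \<Rightarrow> bool" where
  "square_integrable f \<longleftrightarrow>
     f \<in> borel_measurable lborel \<and> integrable lborel (\<lambda>x. (norm (f x))\<^sup>2)"

definition L2_inner :: "(real \<Rightarrow> complex) \<Rightarrow> (real \<Rightarrow> complex) \<Rightarrow> complex" where
  "L2_inner f g = (\<integral>x. f x * cnj (g x) \<partial>lborel)"

definition L2_tendsto :: "(nat \<Rightarrow> real \<Rightarrow> complex) \<Rightarrow> (real \<Rightarrow> complex) \<Rightarrow> bool" where
  "L2_tendsto F f \<longleftrightarrow>
     (\<lambda>k. \<integral>\<^sup>+x. ennreal ((norm (F k x - f x))\<^sup>2) \<partial>lborel) \<longlonglongrightarrow> 0"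

definition fourier :: "(real \<Rightarrow> complex) \<Rightarrow> real \<Rightarrow> complex" where
  "fourier f \<omega> = (\<integral>x. f x * exp (- \<i> * of_real \<omega> * of_real x) \<partial>lborel)"

text \<open>
  The extension by continuity of \<^const>\<open>fourier\<close> from \<open>L\<^sup>1 \<inter> L\<^sup>2\<close> to \<open>L\<^sup>2\<close>, as a relation:
  its graph is the closure in \<open>L\<^sup>2 \<times> L\<^sup>2\<close> of the graph of the integral transform.
  By Plancherel's theorem, \<open>g\<close> exists for every square-integrable \<open>f\<close> and is unique
  almost everywhere.
\<close>

definition has_L2_fourier :: "(real \<Rightarrow> complex) \<Rightarrow> (real \<Rightarrow> complex) \<Rightarrow> bool" where
  "has_L2_fourier f g \<longleftrightarrow>
     square_integrable f \<and> square_integrable g \<and>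
     (\<exists>F. (\<forall>k. integrable lborel (F k) \<and> square_integrable (F k)) \<and>
          L2_tendsto F f \<and> L2_tendsto (\<lambda>k. fourier (F k)) g)"

text \<open>
  A wavelet specified by its Fourier transform is determined only up to a null set, so
  this is a predicate holding of every representative.
\<close>

definition auscher_wavelet :: "int \<Rightarrow> int \<Rightarrow> int \<Rightarrow> (real \<Rightarrow> complex) \<Rightarrow> bool" where
  "auscher_wavelet p q m \<psi> \<longleftrightarrow>
     (\<exists>\<psi>_hat. has_L2_fourier \<psi> \<psi>_hat \<and>
        (AE \<omega> in lborel.
           \<psi>_hat (of_int p / of_int q * \<omega>) =
             (if of_int (q + m - 1) * (pi / of_int p) \<le> \<bar>\<omega>\<bar> \<and>
                 \<bar>\<omega>\<bar> < of_int (q + m) * (pi / of_int p) then 1 else 0)))"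

definition wavelet_system ::
  "int \<Rightarrow> int \<Rightarrow> (int \<Rightarrow> real \<Rightarrow> complex) \<Rightarrow> int \<times> int \<times> int \<Rightarrow> real \<Rightarrow> complex" where
  "wavelet_system p q \<psi> = (\<lambda>(j, n, m) x.
     let M = real_of_int p / real_of_int q
     in of_real (M powr (- of_int j / 2)) * \<psi> m (M powi (- j) * x - of_int (n * q)))"

text \<open>
  Only the inner products are constrained, so the negation cannot hold merely because some
  \<open>f i\<close> fails to be square-integrable.
\<close>

definition L2_orthonormal :: "'i set \<Rightarrow> ('i \<Rightarrow> real \<Rightarrow> complex) \<Rightarrow> bool" where
  "L2_orthonormal I f \<longleftrightarrow>
     (\<forall>i\<in>I. \<forall>k\<in>I. L2_inner (f i) (f k) = (if i = k then 1 else 0))"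

end

theory Submission
  imports Defs "HOL-Probability.Characteristic_Functions"
begin

text \<open>
  The Fourier transform of \<open>\<psi>\<^sup>m\<close> is the indicator of a set of measure \<open>2\<pi>/q\<close>, so Plancherel's
  theorem gives \<open>\<parallel>\<psi>\<^sup>m\<parallel>\<^sup>2 = 1/q\<close>. For \<open>q \<noteq> 1\<close> the member \<open>\<psi>\<^sup>1\<close> (\<open>j = n = 0\<close>) is thus not normalised.

  Plancherel's theorem on \<open>L\<^sup>1 \<inter> L\<^sup>2\<close> comes from the autocorrelation \<open>A\<close> of \<open>f\<close>: if \<open>F\<close> is the
  transform of \<open>f\<close>, that of \<open>A\<close> is \<open>\<bar>F\<bar>\<^sup>2\<close>, so integrating \<open>\<bar>F\<bar>\<^sup>2\<close> against wide Gaussians amounts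
  to averaging \<open>2\<pi> A\<close> over narrow ones, and \<open>A(0) = \<parallel>f\<parallel>\<^sup>2\<close>, where \<open>A\<close> is continuous because translations are continuous in \<open>L\<^sup>2\<close>.
\<close>

section \<open>Continuity of translations\<close>

lemma lborel_integral_shift:
  fixes f :: "real \<Rightarrow> 'a::{banach, second_countable_topology}"
  shows "(\<integral>x. f (x + t) \<partial>lborel) = (\<integral>x. f x \<partial>lborel)"
  using lborel_integral_real_affine[of 1 f t] by (simp add: add.commute)

lemma lborel_integrable_shift:
  fixes f :: "real \<Rightarrow> 'a::{banach, second_countable_topology}"
  assumes "integrable lborel f"
  shows "integrable lborel (\<lambda>x. f (x + t))"
  using lborel_integrable_real_affine[OF assms, of 1 t] by (simp add: add.commute)

text \<open>A three-term estimate: translation invariance makes the shifted error equal to the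
  unshifted one, so an approximant \<open>g\<close> within \<open>e / 4\<close> costs
  \<open>e / 2\<close> in total, uniformly in the shift. This reduces continuity to a class dense in
  \<open>L^1\<close>.\<close>

lemma L1_translation_closed:
  fixes f :: "real \<Rightarrow> 'a::{banach, second_countable_topology}"
  assumes f: "integrable lborel f"
    and approx: "\<And>e. 0 < e \<Longrightarrow> \<exists>g. integrable lborel g \<and> (\<integral>x. norm (f x - g x) \<partial>lborel) < e \<and>
      (\<lambda>n. \<integral>x. norm (g (x + t n) - g x) \<partial>lborel) \<longlonglongrightarrow> 0"
  shows "(\<lambda>n. \<integral>x. norm (f (x + t n) - f x) \<partial>lborel) \<longlonglongrightarrow> 0"
proof (rule LIMSEQ_I)
  fix e :: real assume "0 < e"
  then obtain g where g: "integrable lborel g" and fg: "(\<integral>x. norm (f x - g x) \<partial>lborel) < e / 4"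
    and lim: "(\<lambda>n. \<integral>x. norm (g (x + t n) - g x) \<partial>lborel) \<longlonglongrightarrow> 0"
    using approx[of "e / 4"] by auto
  obtain N where N: "\<And>n. N \<le> n \<Longrightarrow> (\<integral>x. norm (g (x + t n) - g x) \<partial>lborel) < e / 2"
    using LIMSEQ_D[OF lim, of "e / 2"] \<open>0 < e\<close> by auto
  have "norm ((\<integral>x. norm (f (x + t n) - f x) \<partial>lborel) - 0) < e" if "N \<le> n" for n
  proof -
    note [simp] = f g lborel_integrable_shift[OF f] lborel_integrable_shift[OF g]
    have "(\<integral>x. norm (f (x + t n) - f x) \<partial>lborel)
        \<le> (\<integral>x. norm (f (x + t n) - g (x + t n)) + norm (g (x + t n) - g x) + norm (f x - g x) \<partial>lborel)"
    proof (rule integral_mono)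
      fix x
      show "norm (f (x + t n) - f x)
          \<le> norm (f (x + t n) - g (x + t n)) + norm (g (x + t n) - g x) + norm (f x - g x)"
        by norm
    qed auto
    also have "\<dots> = (\<integral>x. norm (f (x + t n) - g (x + t n)) \<partial>lborel)
        + (\<integral>x. norm (g (x + t n) - g x) \<partial>lborel) + (\<integral>x. norm (f x - g x) \<partial>lborel)"
      by simp
    also have "(\<integral>x. norm (f (x + t n) - g (x + t n)) \<partial>lborel) = (\<integral>x. norm (f x - g x) \<partial>lborel)"
      by (rule lborel_integral_shift)
    finally have "(\<integral>x. norm (f (x + t n) - f x) \<partial>lborel) < e"
      using fg N[OF that] by linarith
    then show ?thesis by (simp add: integral_nonneg_AE)
  qed
  then show "\<exists>N. \<forall>n\<ge>N. norm ((\<integral>x. norm (f (x + t n) - f x) \<partial>lborel) - 0) < e"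
    by blast
qed

text \<open>A point of an open set stays inside it under small shifts, so the part of
  \<open>U\<close> that a shift moves out vanishes pointwise and, by domination, in measure. The
  part moved in has the same measure, because translation preserves the finite measure of
  \<open>U\<close>.\<close>

lemma L1_translation_open:
  fixes U :: "real set"
  assumes "open U" and fin: "emeasure lborel U < \<infinity>" and t: "t \<longlonglongrightarrow> 0"
  shows "(\<lambda>n. \<integral>x. norm (indicator U (x + t n) - indicator U x :: real) \<partial>lborel) \<longlonglongrightarrow> 0"
proof -
  let ?I = "indicator U :: real \<Rightarrow> real"
  have [measurable]: "U \<in> sets borel" using \<open>open U\<close> by simp
  have U: "integrable lborel ?I" using fin by simp
  note Us = lborel_integrable_shift[OF U]
  have prod: "integrable lborel (\<lambda>x. ?I x * (1 - ?I (x + t n)))" for n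
    by (rule Bochner_Integration.integrable_bound[OF U]) (auto split: split_indicator)
  have "(\<lambda>n. \<integral>x. ?I x * (1 - ?I (x + t n)) \<partial>lborel) \<longlonglongrightarrow> (\<integral>x. 0 \<partial>(lborel :: real measure))"
  proof (rule integral_dominated_convergence)
    show "AE x in lborel. (\<lambda>n. ?I x * (1 - ?I (x + t n))) \<longlonglongrightarrow> 0"
    proof (rule AE_I2)
      fix x
      show "(\<lambda>n. ?I x * (1 - ?I (x + t n))) \<longlonglongrightarrow> 0"
      proof (cases "x \<in> U")
        case True
        have "(\<lambda>n. x + t n) \<longlonglongrightarrow> x" using tendsto_add[OF tendsto_const t, of x] by simp
        then have "\<forall>\<^sub>F n in sequentially. x + t n \<in> U"
          using \<open>open U\<close> True by (rule topological_tendstoD)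
        then show ?thesis using True by (intro tendsto_eventually) (auto elim!: eventually_mono)
      qed simp
    qed
    show "integrable lborel ?I" by (rule U)
  qed (auto split: split_indicator)
  then have "(\<lambda>n. 2 * (\<integral>x. ?I x * (1 - ?I (x + t n)) \<partial>lborel)) \<longlonglongrightarrow> 0"
    using tendsto_mult_left[of _ "0::real" sequentially 2] by simp
  also have "(\<lambda>n. 2 * (\<integral>x. ?I x * (1 - ?I (x + t n)) \<partial>lborel))
      = (\<lambda>n. \<integral>x. norm (?I (x + t n) - ?I x) \<partial>lborel)"
  proof
    fix n
    \<comment> \<open>For values \<open>a\<close>, \<open>b\<close> in {0, 1} one has
      \<open>|b - a| = (b - a) + 2 * a * (1 - b)\<close>, and the term \<open>b - a\<close>
      integrates to 0 by translation invariance.\<close>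
    have "(\<integral>x. norm (?I (x + t n) - ?I x) \<partial>lborel)
        = (\<integral>x. ?I (x + t n) - ?I x + 2 * (?I x * (1 - ?I (x + t n))) \<partial>lborel)"
      by (intro Bochner_Integration.integral_cong) (auto split: split_indicator)
    also have "\<dots> = 2 * (\<integral>x. ?I x * (1 - ?I (x + t n)) \<partial>lborel)"
      using U Us[of "t n"] prod[of n] by (simp add: lborel_integral_shift del: integrable_indicator_iff)
    finally show "2 * (\<integral>x. ?I x * (1 - ?I (x + t n)) \<partial>lborel)
      = (\<integral>x. norm (?I (x + t n) - ?I x) \<partial>lborel)" by simp
  qed
  finally show ?thesis .
qed

text \<open>Induction over integrable functions: indicators are approximated by open sets, sums use
  the triangle inequality, and limits use closedness in \<open>L^1\<close>.\<close>

lemma L1_translation_continuous: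
  fixes f :: "real \<Rightarrow> 'a::{banach, second_countable_topology}"
  assumes "integrable lborel f" and t: "t \<longlonglongrightarrow> 0"
  shows "(\<lambda>n. \<integral>x. norm (f (x + t n) - f x) \<partial>lborel) \<longlonglongrightarrow> 0"
  using assms(1)
proof (induction rule: integrable_induct)
  case (base A c)
  have A[measurable]: "A \<in> sets borel" using base by simp
  have indA: "integrable lborel (indicator A :: real \<Rightarrow> real)" using base by simp
  have "(\<lambda>n. \<integral>x. norm (indicator A (x + t n) - indicator A x :: real) \<partial>lborel) \<longlonglongrightarrow> 0"
  proof (rule L1_translation_closed[OF indA])
    fix e :: real assume "0 < e"
    \<comment> \<open>Outer regularity supplies an open superset whose indicator is within
      \<open>e\<close> of that of \<open>A\<close> in \<open>L^1\<close>; it serves as the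
      approximant \<open>g\<close>.\<close>
    obtain U where U: "open U" "A \<subseteq> U" "emeasure lborel (U - A) < ennreal e"
      using outer_regular_lborel[OF A \<open>0 < e\<close>] by blast
    have [measurable]: "U \<in> sets borel" using U by simp
    have "emeasure lborel U = emeasure lborel A + emeasure lborel (U - A)"
      using U(2) by (subst plus_emeasure) (auto simp: Un_absorb1)
    then have finU: "emeasure lborel U < \<infinity>"
      using base(2) less_trans[OF U(3) ennreal_less_top] by (simp add: less_top)
    have "(\<integral>x. norm (indicator A x - indicator U x :: real) \<partial>lborel)
        = (\<integral>x. indicator (U - A) x \<partial>lborel)"
      using U(2) by (intro Bochner_Integration.integral_cong) (auto split: split_indicator)
    also have "\<dots> = measure lborel (U - A)" by simp
    also have "\<dots> < e"
      using U(3) less_trans[OF U(3) ennreal_less_top]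
      by (simp add: emeasure_eq_ennreal_measure ennreal_less_iff less_top)
    finally show "\<exists>g. integrable lborel g \<and> (\<integral>x. norm (indicator A x - g x :: real) \<partial>lborel) < e
        \<and> (\<lambda>n. \<integral>x. norm (g (x + t n) - g x) \<partial>lborel) \<longlonglongrightarrow> 0"
      using L1_translation_open[OF U(1) finU t] finU
      by (intro exI[of _ "indicator U"]) simp
  qed
  then have "(\<lambda>n. (\<integral>x. norm (indicator A (x + t n) - indicator A x :: real) \<partial>lborel) * norm c) \<longlonglongrightarrow> 0"
    by (rule tendsto_mult_left_zero)
  moreover have "(\<integral>x. norm (indicator A (x + s) - indicator A x :: real) \<partial>lborel) * norm c
      = (\<integral>x. norm (indicator A (x + s) *\<^sub>R c - indicator A x *\<^sub>R c) \<partial>lborel)" for s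
    by (simp add: scaleR_diff_left[symmetric])
  ultimately show ?case by simp
next
  case (add f g)
  note [simp] = add.hyps lborel_integrable_shift[OF add.hyps(1)] lborel_integrable_shift[OF add.hyps(2)]
  have sum: "(\<lambda>n. (\<integral>x. norm (f (x + t n) - f x) \<partial>lborel) + (\<integral>x. norm (g (x + t n) - g x) \<partial>lborel)) \<longlonglongrightarrow> 0"
    using tendsto_add[OF add.IH] by simp
  show ?case
  proof (rule real_tendsto_sandwich[OF _ _ tendsto_const sum])
    have "(\<integral>x. norm (f (x + t n) + g (x + t n) - (f x + g x)) \<partial>lborel)
        \<le> (\<integral>x. norm (f (x + t n) - f x) + norm (g (x + t n) - g x) \<partial>lborel)" for n
      by (rule integral_mono) (auto intro: norm_diff_triangle_ineq)
    then show "\<forall>\<^sub>F n in sequentially. (\<integral>x. norm (f (x + t n) + g (x + t n) - (f x + g x)) \<partial>lborel)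
        \<le> (\<integral>x. norm (f (x + t n) - f x) \<partial>lborel) + (\<integral>x. norm (g (x + t n) - g x) \<partial>lborel)"
      by simp
  qed (simp add: integral_nonneg_AE)
next
  case (lim f s)
  show ?case
  proof (rule L1_translation_closed[OF lim.hyps(4)])
    fix e :: real assume "0 < e"
    have "(\<lambda>i. \<integral>x. norm (f x - s i x) \<partial>lborel) \<longlonglongrightarrow> (\<integral>x. 0 \<partial>(lborel :: real measure))"
    proof (rule integral_dominated_convergence)
      \<comment> \<open>The induction rule provides simple functions with
        \<open>norm (s i x) <= 2 * norm (f x)\<close>, whence the factor 3 for the
        difference.\<close>
      show "integrable lborel (\<lambda>x. 3 * norm (f x))" using lim.hyps(4) by simp
      show "AE x in lborel. (\<lambda>i. norm (f x - s i x)) \<longlonglongrightarrow> 0"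
      proof (rule AE_I2)
        fix x
        have "(\<lambda>i. norm (f x - s i x)) \<longlonglongrightarrow> norm (f x - f x)"
          by (intro tendsto_intros lim.hyps(2)) simp
        then show "(\<lambda>i. norm (f x - s i x)) \<longlonglongrightarrow> 0" by simp
      qed
      show "AE x in lborel. norm (norm (f x - s i x)) \<le> 3 * norm (f x)" for i
      proof (rule AE_I2)
        fix x
        show "norm (norm (f x - s i x)) \<le> 3 * norm (f x)"
          using lim.hyps(3)[of x i] norm_triangle_ineq4[of "f x" "s i x"] by simp
      qed
    qed (use lim.hyps(1,4) in auto)
    then obtain i where "(\<integral>x. norm (f x - s i x) \<partial>lborel) < e"
      using LIMSEQ_D[OF _ \<open>0 < e\<close>] by fastforce
    then show "\<exists>g. integrable lborel g \<and> (\<integral>x. norm (f x - g x) \<partial>lborel) < e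
        \<and> (\<lambda>n. \<integral>x. norm (g (x + t n) - g x) \<partial>lborel) \<longlonglongrightarrow> 0"
      using lim.hyps(1) lim.IH by blast
  qed
qed

section \<open>Continuity of translations in \<open>L^2\<close>\<close>

lemma borel_measurable_cnj [measurable]: "cnj \<in> borel_measurable borel"
  by (intro borel_measurable_continuous_onI continuous_intros)

text \<open>The map \<open>f \<mapsto> \<bar>f\<bar> f\<close> carries \<open>L\<^sup>2\<close> to \<open>L\<^sup>1\<close>; this bound for its inverse transfers
  continuity of translations from \<open>L\<^sup>1\<close> to \<open>L\<^sup>2\<close>.\<close>

lemma norm_diff_power2_le:
  fixes a b :: "'a::real_inner"
  shows "(norm (a - b))\<^sup>2 \<le> 2 * norm (norm a *\<^sub>R a - norm b *\<^sub>R b)"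
proof -
  let ?r = "norm a" and ?s = "norm b"
  let ?c = "?r *\<^sub>R a - ?s *\<^sub>R b"
  \<comment> \<open>In this splitting the cross term of the squared norm is
    \<open>2 * ((?r + ?s) * (?r - ?s))^2\<close>, since
    \<open>(a - b) \<bullet> (a + b) = ?r^2 - ?s^2\<close>. It is nonnegative, so the first summand
    alone is bounded by \<open>?c + ?c\<close>; then \<open>norm (a - b) \<le> ?r + ?s\<close>
    finishes.\<close>
  have "?c + ?c = (?r + ?s) *\<^sub>R (a - b) + (?r - ?s) *\<^sub>R (a + b)"
    by (simp add: algebra_simps)
  then have "(norm (?c + ?c))\<^sup>2
      = (norm ((?r + ?s) *\<^sub>R (a - b)))\<^sup>2 + 2 * ((?r + ?s) * (?r - ?s) * ((a - b) \<bullet> (a + b)))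
        + (norm ((?r - ?s) *\<^sub>R (a + b)))\<^sup>2"
    by (simp only: power2_norm_eq_inner)
      (simp add: inner_add_left inner_add_right inner_commute algebra_simps)
  also have "(a - b) \<bullet> (a + b) = (?r + ?s) * (?r - ?s)"
    by (simp add: inner_diff_left inner_add_right inner_commute power2_norm_eq_inner[symmetric]
        power2_eq_square algebra_simps)
  also have "(?r + ?s) * (?r - ?s) * ((?r + ?s) * (?r - ?s)) = ((?r + ?s) * (?r - ?s))\<^sup>2"
    by (simp only: power2_eq_square)
  finally have "(norm ((?r + ?s) *\<^sub>R (a - b)))\<^sup>2 \<le> (norm (?c + ?c))\<^sup>2"
    using zero_le_power2[of "(?r + ?s) * (?r - ?s)"] zero_le_power2[of "norm ((?r - ?s) *\<^sub>R (a + b))"]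
    by linarith
  then have "norm ((?r + ?s) *\<^sub>R (a - b)) \<le> norm (?c + ?c)"
    by (rule power2_le_imp_le) simp
  also have "\<dots> \<le> norm ?c + norm ?c" by (rule norm_triangle_ineq)
  finally have "(?r + ?s) * norm (a - b) \<le> 2 * norm ?c" by simp
  moreover have "norm (a - b) * norm (a - b) \<le> (?r + ?s) * norm (a - b)"
    by (intro mult_right_mono norm_triangle_ineq4 norm_ge_zero)
  ultimately show ?thesis
    by (simp add: power2_eq_square)
qed

lemma L2_translation_continuous:
  assumes f: "square_integrable f" and t: "t \<longlonglongrightarrow> 0"
  shows "(\<lambda>n. \<integral>x. (norm (f (x + t n) - f x))\<^sup>2 \<partial>lborel) \<longlonglongrightarrow> 0"
proof -
  have [measurable]: "f \<in> borel_measurable borel"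
    using f by (simp add: square_integrable_def)
  let ?h = "\<lambda>x. norm (f x) *\<^sub>R f x"
  have h: "integrable lborel ?h"
    by (rule Bochner_Integration.integrable_bound[of _ "\<lambda>x. (norm (f x))\<^sup>2"])
      (use f in \<open>auto simp: square_integrable_def power2_eq_square norm_mult\<close>)
  have "(\<lambda>n. 2 * (\<integral>x. norm (?h (x + t n) - ?h x) \<partial>lborel)) \<longlonglongrightarrow> 0"
    using tendsto_mult_left[OF L1_translation_continuous[OF h t], of 2] by simp
  then show ?thesis
  proof (rule real_tendsto_sandwich[OF _ _ tendsto_const, rotated 2])
    show "\<forall>\<^sub>F n in sequentially. (\<integral>x. (norm (f (x + t n) - f x))\<^sup>2 \<partial>lborel)
        \<le> 2 * (\<integral>x. norm (?h (x + t n) - ?h x) \<partial>lborel)"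
    proof (rule always_eventually, rule allI)
      fix n
      have "(\<integral>x. (norm (f (x + t n) - f x))\<^sup>2 \<partial>lborel)
          \<le> (\<integral>x. 2 * norm (?h (x + t n) - ?h x) \<partial>lborel)"
        by (rule integral_mono_AE')
          (use h lborel_integrable_shift[OF h, of "t n"] norm_diff_power2_le in auto)
      then show "(\<integral>x. (norm (f (x + t n) - f x))\<^sup>2 \<partial>lborel)
          \<le> 2 * (\<integral>x. norm (?h (x + t n) - ?h x) \<partial>lborel)" by simp
    qed
  qed (simp add: integral_nonneg_AE)
qed

lemma square_integrable_shift:
  "square_integrable f \<Longrightarrow> square_integrable (\<lambda>x. f (x + t))"
  using lborel_integrable_shift[of "\<lambda>x. (norm (f x))\<^sup>2" t]
  by (auto simp: square_integrable_def)

lemma square_integrable_mult_cnj: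
  assumes "square_integrable f" "square_integrable g"
  shows "integrable lborel (\<lambda>x. f x * cnj (g x))"
proof (rule Bochner_Integration.integrable_bound)
  show "integrable lborel (\<lambda>x. (norm (f x))\<^sup>2 + (norm (g x))\<^sup>2)"
    using assms by (simp add: square_integrable_def)
  have [measurable]: "f \<in> borel_measurable borel" "g \<in> borel_measurable borel"
    using assms by (auto simp: square_integrable_def)
  show "(\<lambda>x. f x * cnj (g x)) \<in> borel_measurable lborel" by measurable
  have "norm (f x * cnj (g x)) \<le> (norm (f x))\<^sup>2 + (norm (g x))\<^sup>2" for x
    using sum_squares_bound[of "norm (f x)" "norm (g x)"]
      mult_nonneg_nonneg[OF norm_ge_zero[of "f x"] norm_ge_zero[of "g x"]]
    unfolding norm_mult complex_mod_cnj by linarith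
  then show "AE x in lborel. norm (f x * cnj (g x)) \<le> norm ((norm (f x))\<^sup>2 + (norm (g x))\<^sup>2)"
    by simp
qed

section \<open>Autocorrelation and the Fourier transform\<close>

definition autocorrelation :: "(real \<Rightarrow> complex) \<Rightarrow> real \<Rightarrow> complex" where
  "autocorrelation f t = (\<integral>x. f (x + t) * cnj (f x) \<partial>lborel)"

text \<open>Expand the square and use translation invariance. This converts continuity of
  translations in \<open>L^2\<close> into continuity of the real part of the autocorrelation at
  0.\<close>

lemma Re_autocorrelation:
  assumes f: "square_integrable f"
  shows "Re (autocorrelation f t)
    = (\<integral>x. (norm (f x))\<^sup>2 \<partial>lborel) - (\<integral>x. (norm (f (x + t) - f x))\<^sup>2 \<partial>lborel) / 2"
proof -
  note ft = square_integrable_shift[OF f, of t]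
  have prod: "integrable lborel (\<lambda>x. f (x + t) * cnj (f x))"
    by (rule square_integrable_mult_cnj[OF ft f])
  have "(norm (f (x + t) - f x))\<^sup>2
      = (norm (f (x + t)))\<^sup>2 + (norm (f x))\<^sup>2 - 2 * Re (f (x + t) * cnj (f x))" for x
    unfolding cmod_power2 by (simp add: power2_eq_square algebra_simps)
  then have "(\<integral>x. (norm (f (x + t) - f x))\<^sup>2 \<partial>lborel)
      = (\<integral>x. (norm (f (x + t)))\<^sup>2 + (norm (f x))\<^sup>2 - 2 * Re (f (x + t) * cnj (f x)) \<partial>lborel)"
    by simp
  also have "\<dots> = (\<integral>x. (norm (f (x + t)))\<^sup>2 \<partial>lborel) + (\<integral>x. (norm (f x))\<^sup>2 \<partial>lborel)
      - 2 * Re (autocorrelation f t)"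
    using f ft integrable_Re[OF prod] integral_Re[OF prod] unfolding autocorrelation_def
    by (simp add: square_integrable_def del: times_complex.sel)
  also have "(\<integral>x. (norm (f (x + t)))\<^sup>2 \<partial>lborel) = (\<integral>x. (norm (f x))\<^sup>2 \<partial>lborel)"
    by (rule lborel_integral_shift)
  finally show ?thesis by linarith
qed

text \<open>The arithmetic-geometric mean inequality loses nothing against Cauchy-Schwarz here,
  because both factors have the same \<open>L^2\<close> norm. The bound is uniform in
  \<open>t\<close> and later provides a dominating function.\<close>

lemma norm_autocorrelation_le:
  assumes f: "square_integrable f"
  shows "norm (autocorrelation f t) \<le> (\<integral>x. (norm (f x))\<^sup>2 \<partial>lborel)"
proof -
  note ft = square_integrable_shift[OF f, of t]
  have "norm (autocorrelation f t) \<le> (\<integral>x. norm (f (x + t) * cnj (f x)) \<partial>lborel)"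
    unfolding autocorrelation_def by (rule integral_norm_bound)
  also have "\<dots> \<le> (\<integral>x. ((norm (f (x + t)))\<^sup>2 + (norm (f x))\<^sup>2) / 2 \<partial>lborel)"
  proof (rule integral_mono)
    show "integrable lborel (\<lambda>x. norm (f (x + t) * cnj (f x)))"
      using square_integrable_mult_cnj[OF ft f] by (rule integrable_norm)
    show "norm (f (x + t) * cnj (f x)) \<le> ((norm (f (x + t)))\<^sup>2 + (norm (f x))\<^sup>2) / 2" for x
      using sum_squares_bound[of "norm (f (x + t))" "norm (f x)"] by (simp add: norm_mult)
  qed (use f ft in \<open>auto simp: square_integrable_def\<close>)
  also have "\<dots> = ((\<integral>x. (norm (f (x + t)))\<^sup>2 \<partial>lborel) + (\<integral>x. (norm (f x))\<^sup>2 \<partial>lborel)) / 2"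
    using f ft by (simp add: square_integrable_def)
  also have "(\<integral>x. (norm (f (x + t)))\<^sup>2 \<partial>lborel) = (\<integral>x. (norm (f x))\<^sup>2 \<partial>lborel)"
    by (rule lborel_integral_shift)
  finally show ?thesis by simp
qed

lemma autocorrelation_measurable:
  assumes "f \<in> borel_measurable borel"
  shows "autocorrelation f \<in> borel_measurable borel"
proof -
  note assms[measurable]
  show ?thesis unfolding autocorrelation_def[abs_def] by measurable
qed

lemma fourier_measurable:
  assumes "f \<in> borel_measurable borel"
  shows "fourier f \<in> borel_measurable borel"
proof -
  note assms[measurable]
  show ?thesis unfolding fourier_def[abs_def] by measurable
qed

lemma norm_exp_minus_ii_of_real [simp]: "norm (exp (- \<i> * of_real a * of_real b)) = 1"
  by (simp add: norm_exp_eq_Re)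

lemma norm_fourier_le: "norm (fourier f \<omega>) \<le> (\<integral>x. norm (f x) \<partial>lborel)"
proof -
  have "norm (fourier f \<omega>) \<le> (\<integral>x. norm (f x * exp (- \<i> * of_real \<omega> * of_real x)) \<partial>lborel)"
    unfolding fourier_def by (rule integral_norm_bound)
  then show ?thesis by (simp only: norm_mult norm_exp_minus_ii_of_real mult_1_right)
qed

text \<open>The multiplication formula: the exponential is symmetric in \<open>x\<close> and
  \<open>\<omega>\<close> and has modulus 1, so the kernel is dominated by a product of integrable
  functions and Fubini applies.\<close>

lemma integral_fourier_mult:
  assumes f: "integrable lborel f" and g: "integrable lborel g"
  shows "(\<integral>\<omega>. fourier f \<omega> * g \<omega> \<partial>lborel) = (\<integral>x. f x * fourier g x \<partial>lborel)"
proof -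
  have [measurable]: "f \<in> borel_measurable borel" "g \<in> borel_measurable borel"
    using f g by auto
  let ?K = "\<lambda>x \<omega>. f x * exp (- \<i> * of_real \<omega> * of_real x) * g \<omega>"
  have nK: "norm (?K x \<omega>) = norm (f x) * norm (g \<omega>)" for x \<omega>
    by (simp only: norm_mult norm_exp_minus_ii_of_real mult_1_right)
  have slice: "integrable lborel (?K x)" for x
    by (rule Bochner_Integration.integrable_bound[of _ "\<lambda>\<omega>. f x * g \<omega>"])
      (use g nK in \<open>auto simp: norm_mult\<close>)
  have "integrable (lborel \<Otimes>\<^sub>M lborel) (case_prod ?K)"
  proof (rule lborel_pair.Fubini_integrable)
    show "case_prod ?K \<in> borel_measurable (lborel \<Otimes>\<^sub>M lborel)" by measurable
    show "integrable lborel (\<lambda>x. \<integral>\<omega>. norm (case_prod ?K (x, \<omega>)) \<partial>lborel)"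
      unfolding split nK using f by simp
    show "AE x in lborel. integrable lborel (\<lambda>\<omega>. case_prod ?K (x, \<omega>))"
      using slice by simp
  qed
  then have "(\<integral>\<omega>. \<integral>x. ?K x \<omega> \<partial>lborel \<partial>lborel) = (\<integral>x. \<integral>\<omega>. ?K x \<omega> \<partial>lborel \<partial>lborel)"
    by (rule lborel_pair.Fubini_integral)
  also have "(\<lambda>\<omega>. \<integral>x. ?K x \<omega> \<partial>lborel) = (\<lambda>\<omega>. fourier f \<omega> * g \<omega>)"
    unfolding fourier_def integral_mult_left_zero ..
  also have "(\<lambda>x. \<integral>\<omega>. ?K x \<omega> \<partial>lborel) = (\<lambda>x. f x * fourier g x)"
    unfolding fourier_def integral_mult_right_zero[symmetric] by (simp only: mult_ac)
  finally show ?thesis .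
qed

text \<open>Integrating the modulus in \<open>t\<close> first gives the \<open>L^1\<close> norm of
  \<open>f\<close> times \<open>norm (f x)\<close>, which is integrable in \<open>x\<close>.\<close>

lemma autocorrelation_kernel_integrable:
  fixes f :: "real \<Rightarrow> complex"
  assumes f: "integrable lborel f"
  shows "integrable (lborel \<Otimes>\<^sub>M lborel) (\<lambda>(x, t :: real). f (x + t) * cnj (f x))"
proof (rule lborel_pair.Fubini_integrable)
  have [measurable]: "f \<in> borel_measurable borel" using f by auto
  show "(\<lambda>(x, t). f (x + t) * cnj (f x)) \<in> borel_measurable (lborel \<Otimes>\<^sub>M lborel)"
    by measurable
  have "(\<integral>t. norm (f (x + t) * cnj (f x)) \<partial>lborel) = (\<integral>t. norm (f t) \<partial>lborel) * norm (f x)" for x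
    using lborel_integral_shift[of "\<lambda>t. norm (f t)" x] by (simp add: norm_mult add.commute)
  then show "integrable lborel (\<lambda>x. \<integral>t. norm ((\<lambda>(x, t). f (x + t) * cnj (f x)) (x, t)) \<partial>lborel)"
    using f by simp
  show "AE x in lborel. integrable lborel (\<lambda>t. (\<lambda>(x, t). f (x + t) * cnj (f x)) (x, t))"
    using lborel_integrable_shift[OF f] by (simp add: add.commute)
qed

lemma autocorrelation_integrable:
  assumes "integrable lborel f"
  shows "integrable lborel (autocorrelation f)"
  using lborel_pair.integrable_snd[OF autocorrelation_kernel_integrable[OF assms]]
  unfolding autocorrelation_def[abs_def] .

text \<open>The autocorrelation is the convolution of \<open>f\<close> with its reflected conjugate,
  so its transform is the transform of \<open>f\<close> times the conjugate of that
  transform.\<close>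

lemma fourier_autocorrelation:
  assumes f: "integrable lborel f"
  shows "fourier (autocorrelation f) \<omega> = of_real ((norm (fourier f \<omega>))\<^sup>2)"
proof -
  have [measurable]: "f \<in> borel_measurable borel" using f by auto
  let ?E = "\<lambda>x. exp (- \<i> * of_real \<omega> * of_real x)"
  let ?K = "\<lambda>x t. f (x + t) * cnj (f x) * ?E t"
  have "integrable (lborel \<Otimes>\<^sub>M lborel) (case_prod ?K)"
  proof (rule Bochner_Integration.integrable_bound[OF autocorrelation_kernel_integrable[OF f]])
    show "case_prod ?K \<in> borel_measurable (lborel \<Otimes>\<^sub>M lborel)" by measurable
    show "AE p in lborel \<Otimes>\<^sub>M lborel. norm (case_prod ?K p) \<le> norm ((\<lambda>(x, t). f (x + t) * cnj (f x)) p)"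
      by (rule AE_I2) (auto simp only: split_beta norm_mult norm_exp_minus_ii_of_real mult_1_right)
  qed
  then have "(\<integral>t. \<integral>x. ?K x t \<partial>lborel \<partial>lborel) = (\<integral>x. \<integral>t. ?K x t \<partial>lborel \<partial>lborel)"
    by (rule lborel_pair.Fubini_integral)
  also have "(\<integral>t. \<integral>x. ?K x t \<partial>lborel \<partial>lborel) = fourier (autocorrelation f) \<omega>"
    unfolding fourier_def autocorrelation_def by simp
  also have "(\<lambda>x. \<integral>t. ?K x t \<partial>lborel) = (\<lambda>x. fourier f \<omega> * cnj (f x * ?E x))"
  proof
    fix x
    \<comment> \<open>The character is multiplicative and has inverse \<open>cnj (?E x)\<close>;
      this separates the shifted variable \<open>t + x\<close> from \<open>x\<close>.\<close>
    have E: "?E t = ?E (t + x) * cnj (?E x)" for t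
      by (simp add: exp_cnj mult_exp_exp algebra_simps)
    have "?K x t = f (t + x) * ?E (t + x) * cnj (f x * ?E x)" for t
      unfolding E[of t] by (simp only: complex_cnj_mult mult_ac add.commute)
    then have "(\<integral>t. ?K x t \<partial>lborel) = (\<integral>t. f (t + x) * ?E (t + x) \<partial>lborel) * cnj (f x * ?E x)"
      by (simp only: integral_mult_left_zero)
    also have "(\<integral>t. f (t + x) * ?E (t + x) \<partial>lborel) = fourier f \<omega>"
      unfolding fourier_def by (rule lborel_integral_shift)
    finally show "(\<integral>t. ?K x t \<partial>lborel) = fourier f \<omega> * cnj (f x * ?E x)" .
  qed
  also have "(\<integral>x. fourier f \<omega> * cnj (f x * ?E x) \<partial>lborel) = fourier f \<omega> * cnj (fourier f \<omega>)"
    by (simp only: integral_mult_right_zero Bochner_Integration.integral_cnj fourier_def[symmetric])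
  finally show ?thesis
    by (simp only: complex_norm_square)
qed

section \<open>Gaussian weights\<close>

lemma std_normal_density_affine_integrable:
  assumes "s \<noteq> 0"
  shows "integrable lborel (\<lambda>x. std_normal_density (s * x))"
  using lborel_integrable_real_affine[of std_normal_density s 0] assms by simp

lemma fourier_std_normal_density:
  assumes "0 < s"
  shows "fourier (\<lambda>x. of_real (std_normal_density (s * x))) t = of_real (exp (- (t / s)\<^sup>2 / 2) / s)"
proof -
  \<comment> \<open>\<open>char\<close> integrates against \<open>exp (i t u)\<close> whereas
    \<open>fourier\<close> carries a minus sign, hence the argument \<open>- t / s\<close>; the
    substitution \<open>u = s * x\<close> then produces the factor \<open>s\<close>.\<close>
  have "of_real (exp (- (t / s)\<^sup>2 / 2)) = char std_normal_distribution (- t / s)"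
    by (simp add: char_std_normal_distribution)
  also have "\<dots> = (\<integral>u. std_normal_density u *\<^sub>R iexp (- t / s * u) \<partial>lborel)"
    unfolding char_def by (subst integral_density) auto
  also have "\<dots> = s *\<^sub>R (\<integral>x. std_normal_density (s * x) *\<^sub>R iexp (- t / s * (s * x)) \<partial>lborel)"
    using assms by (subst lborel_integral_real_affine[where c = s and t = 0]) auto
  also have "(\<integral>x. std_normal_density (s * x) *\<^sub>R iexp (- t / s * (s * x)) \<partial>lborel)
      = fourier (\<lambda>x. of_real (std_normal_density (s * x))) t"
    unfolding fourier_def using assms by (simp add: scaleR_conv_of_real mult.assoc)
  finally show ?thesis
    using assms by (simp add: scaleR_conv_of_real field_simps)
qed

lemma exp_eq_std_normal_density: "exp (- x\<^sup>2 / 2) = sqrt (2 * pi) * std_normal_density x"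
  by (simp add: std_normal_density_def)

text \<open>Apply the multiplication formula to the autocorrelation and a Gaussian. The weight is
  \<open>sqrt (2 * pi)\<close> times a density, and the transform of the density gives a second
  \<open>sqrt (2 * pi)\<close>; together they form \<open>2 * pi\<close>.\<close>

lemma integral_norm_fourier_gauss:
  assumes f: "integrable lborel f" and "0 < s"
  shows "(\<integral>\<omega>. (norm (fourier f \<omega>))\<^sup>2 * exp (- (s * \<omega>)\<^sup>2 / 2) \<partial>lborel)
    = 2 * pi * (\<integral>z. std_normal_density z * Re (autocorrelation f (s * z)) \<partial>lborel)"
proof -
  let ?A = "autocorrelation f" and ?G = "\<lambda>x. complex_of_real (std_normal_density (s * x))"
  have G: "integrable lborel ?G"
    using std_normal_density_affine_integrable[of s] assms by simp
  note A = autocorrelation_integrable[OF f]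
  have [measurable]: "?A \<in> borel_measurable borel" using A by simp
  have Gs: "fourier ?G (s * z) = of_real (sqrt (2 * pi) * std_normal_density z / s)" for z
    using \<open>0 < s\<close> unfolding fourier_std_normal_density[OF \<open>0 < s\<close>]
    by (simp only: nonzero_mult_div_cancel_left exp_eq_std_normal_density)
  have "complex_of_real (\<integral>\<omega>. (norm (fourier f \<omega>))\<^sup>2 * exp (- (s * \<omega>)\<^sup>2 / 2) \<partial>lborel)
      = (\<integral>\<omega>. of_real (sqrt (2 * pi)) * (fourier ?A \<omega> * ?G \<omega>) \<partial>lborel)"
    unfolding integral_complex_of_real[symmetric]
    by (intro Bochner_Integration.integral_cong refl)
      (simp only: fourier_autocorrelation[OF f] exp_eq_std_normal_density of_real_mult mult_ac)
  also have "\<dots> = of_real (sqrt (2 * pi)) * (\<integral>t. ?A t * fourier ?G t \<partial>lborel)"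
    unfolding integral_mult_right_zero integral_fourier_mult[OF A G] ..
  \<comment> \<open>Rescaling by \<open>t = s * z\<close> cancels the factor \<open>1 / s\<close> in
    the transform of the Gaussian and leaves a fixed density, with \<open>s\<close> only inside the
    autocorrelation.\<close>
  also have "(\<integral>t. ?A t * fourier ?G t \<partial>lborel) = s *\<^sub>R (\<integral>z. ?A (s * z) * fourier ?G (s * z) \<partial>lborel)"
    using \<open>0 < s\<close> by (subst lborel_integral_real_affine[where c = s and t = 0]) auto
  also have "\<dots> = (\<integral>z. of_real (sqrt (2 * pi)) * (of_real (std_normal_density z) * ?A (s * z)) \<partial>lborel)"
    unfolding integral_scaleR_right[symmetric] Gs
    using \<open>0 < s\<close>
    by (intro Bochner_Integration.integral_cong refl) (simp add: scaleR_conv_of_real)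
  also have "of_real (sqrt (2 * pi)) * \<dots>
      = of_real (2 * pi) * (\<integral>z. of_real (std_normal_density z) * ?A (s * z) \<partial>lborel)"
    unfolding integral_mult_right_zero
    by (simp only: mult.assoc[symmetric] of_real_mult[symmetric] real_sqrt_mult_self) simp
  finally have eq: "complex_of_real (\<integral>\<omega>. (norm (fourier f \<omega>))\<^sup>2 * exp (- (s * \<omega>)\<^sup>2 / 2) \<partial>lborel)
      = of_real (2 * pi) * (\<integral>z. of_real (std_normal_density z) * ?A (s * z) \<partial>lborel)" .
  have int: "integrable lborel (\<lambda>z. of_real (std_normal_density z) * ?A (s * z))"
  proof (rule Bochner_Integration.integrable_bound)
    show "integrable lborel (\<lambda>z. ?A (s * z))"
      using lborel_integrable_real_affine[OF A, of s 0] \<open>0 < s\<close> by simp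
    have "std_normal_density z \<le> 1" for z
    proof -
      have "exp (- z\<^sup>2 / 2) \<le> 1" by simp
      also have "1 \<le> sqrt (2 * pi)" using pi_gt3 by simp
      finally show ?thesis by (simp add: std_normal_density_def)
    qed
    then show "AE z in lborel. norm (of_real (std_normal_density z) * ?A (s * z)) \<le> norm (?A (s * z))"
      by (simp add: norm_mult mult_left_le_one_le)
  qed measurable
  show ?thesis
    using arg_cong[OF eq, of Re] integral_Re[OF int] by simp
qed

section \<open>Plancherel's theorem\<close>

text \<open>Letting the Gaussian weight tend to \<open>1\<close>, the left side of the previous identity converges
  monotonically, and the right side by continuity of the autocorrelation at \<open>0\<close>.\<close>

lemma plancherel_L1_L2:
  assumes f: "integrable lborel f" "square_integrable f"
  shows "(\<integral>\<^sup>+\<omega>. ennreal ((norm (fourier f \<omega>))\<^sup>2) \<partial>lborel)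
    = ennreal (2 * pi * (\<integral>x. (norm (f x))\<^sup>2 \<partial>lborel))"
proof -
  let ?N = "\<integral>x. (norm (f x))\<^sup>2 \<partial>lborel"
  let ?s = "\<lambda>n. 1 / real (Suc n)"
  let ?u = "\<lambda>n \<omega>. (norm (fourier f \<omega>))\<^sup>2 * exp (- (?s n * \<omega>)\<^sup>2 / 2)"
  have [measurable]: "f \<in> borel_measurable borel" using f by auto
  note [measurable] = fourier_measurable[OF this] autocorrelation_measurable[OF this]
  have s0: "?s \<longlonglongrightarrow> 0" by (rule LIMSEQ_Suc[OF lim_1_over_n])
  \<comment> \<open>The uniform bound on the autocorrelation gives the dominating function
    \<open>std_normal_density z * ?N\<close>, whose integral is \<open>?N\<close> because the
    density has mass 1.\<close>
  have "(\<lambda>n. \<integral>z. std_normal_density z * Re (autocorrelation f (?s n * z)) \<partial>lborel)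
      \<longlonglongrightarrow> (\<integral>z. std_normal_density z * ?N \<partial>lborel)"
  proof (rule integral_dominated_convergence)
    show "integrable lborel (\<lambda>z. std_normal_density z * ?N)" by simp
    show "AE z in lborel. (\<lambda>n. std_normal_density z * Re (autocorrelation f (?s n * z)))
        \<longlonglongrightarrow> std_normal_density z * ?N"
    proof (rule AE_I2)
      fix z
      have "(\<lambda>n. ?s n * z) \<longlonglongrightarrow> 0" using s0 by (rule tendsto_mult_left_zero)
      from L2_translation_continuous[OF f(2) this]
      have "(\<lambda>n. Re (autocorrelation f (?s n * z))) \<longlonglongrightarrow> ?N - 0 / 2"
        unfolding Re_autocorrelation[OF f(2)] by (intro tendsto_intros) auto
      then show "(\<lambda>n. std_normal_density z * Re (autocorrelation f (?s n * z)))
          \<longlonglongrightarrow> std_normal_density z * ?N"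
        by (intro tendsto_mult_left) simp
    qed
    show "AE z in lborel. norm (std_normal_density z * Re (autocorrelation f (?s n * z)))
        \<le> std_normal_density z * ?N" for n
      using order_trans[OF abs_Re_le_cmod norm_autocorrelation_le[OF f(2)]]
      by (auto simp: abs_mult intro!: mult_left_mono)
  qed simp_all
  then have "(\<lambda>n. 2 * pi * (\<integral>z. std_normal_density z * Re (autocorrelation f (?s n * z)) \<partial>lborel))
      \<longlonglongrightarrow> 2 * pi * ?N"
    by (intro tendsto_mult_left) simp
  then have "(\<lambda>n. \<integral>\<omega>. ?u n \<omega> \<partial>lborel) \<longlonglongrightarrow> 2 * pi * ?N"
    by (subst integral_norm_fourier_gauss[OF f(1)]) auto
  then have lim1: "(\<lambda>n. ennreal (\<integral>\<omega>. ?u n \<omega> \<partial>lborel)) \<longlonglongrightarrow> ennreal (2 * pi * ?N)"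
    by (rule tendsto_ennrealI)
  \<comment> \<open>The transform is bounded by the \<open>L^1\<close> norm of \<open>f\<close>, so
    the Gaussian weight ensures integrability before that of the squared transform is known. The
    Bochner integrals can then be read as nonnegative integrals for monotone convergence.\<close>
  have "integrable lborel (?u n)" for n
  proof (rule Bochner_Integration.integrable_bound)
    show "integrable lborel (\<lambda>\<omega>. (\<integral>x. norm (f x) \<partial>lborel)\<^sup>2
        * (sqrt (2 * pi) * std_normal_density (?s n * \<omega>)))"
      using std_normal_density_affine_integrable[of "?s n"] by simp
    have "(norm (fourier f \<omega>))\<^sup>2 \<le> (\<integral>x. norm (f x) \<partial>lborel)\<^sup>2" for \<omega>
      by (intro power_mono norm_fourier_le norm_ge_zero)
    then show "AE \<omega> in lborel. norm (?u n \<omega>) \<le> norm ((\<integral>x. norm (f x) \<partial>lborel)\<^sup>2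
        * (sqrt (2 * pi) * std_normal_density (?s n * \<omega>)))"
      unfolding exp_eq_std_normal_density by (simp add: abs_mult mult_right_mono)
  qed simp
  then have "ennreal (\<integral>\<omega>. ?u n \<omega> \<partial>lborel) = (\<integral>\<^sup>+\<omega>. ennreal (?u n \<omega>) \<partial>lborel)" for n
    by (intro nn_integral_eq_integral[symmetric]) auto
  with lim1 have lim1': "(\<lambda>n. \<integral>\<^sup>+\<omega>. ennreal (?u n \<omega>) \<partial>lborel) \<longlonglongrightarrow> ennreal (2 * pi * ?N)"
    by (simp only:)
  have lim2: "(\<lambda>n. \<integral>\<^sup>+\<omega>. ennreal (?u n \<omega>) \<partial>lborel)
      \<longlonglongrightarrow> (\<integral>\<^sup>+\<omega>. ennreal ((norm (fourier f \<omega>))\<^sup>2) \<partial>lborel)"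
  proof (rule nn_integral_LIMSEQ)
    show "incseq (\<lambda>n \<omega>. ennreal (?u n \<omega>))"
    proof (intro incseq_SucI le_funI ennreal_leI mult_left_mono)
      fix n \<omega>
      have "\<bar>?s (Suc n) * \<omega>\<bar> \<le> \<bar>?s n * \<omega>\<bar>"
        unfolding abs_mult by (intro mult_right_mono) (auto simp: field_simps)
      then show "exp (- (?s (Suc n) * \<omega>)\<^sup>2 / 2) \<ge> exp (- (?s n * \<omega>)\<^sup>2 / 2)"
        by (simp only: exp_le_cancel_iff abs_le_square_iff divide_right_mono neg_le_iff_le zero_le_numeral)
    qed simp
    show "(\<lambda>n. ennreal (?u n \<omega>)) \<longlonglongrightarrow> ennreal ((norm (fourier f \<omega>))\<^sup>2)" for \<omega>
    proof (rule tendsto_ennrealI)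
      have "(\<lambda>n. ?u n \<omega>) \<longlonglongrightarrow> (norm (fourier f \<omega>))\<^sup>2 * exp (- (0 * \<omega>)\<^sup>2 / 2)"
        by (intro tendsto_intros s0) auto
      then show "(\<lambda>n. ?u n \<omega>) \<longlonglongrightarrow> (norm (fourier f \<omega>))\<^sup>2" by simp
    qed
  qed simp
  show ?thesis by (rule LIMSEQ_unique[OF lim2 lim1'])
qed

section \<open>Passage to limits in \<open>L^2\<close>\<close>

text \<open>With \<open>u = norm (a - b)\<close> the left side is at most
  \<open>u * (u + 2 * norm b)\<close>, and Young's inequality with weight \<open>\<delta>\<close>
  splits the mixed term. Being pointwise, the bound can be integrated directly.\<close>

lemma abs_diff_norm_power2_le:
  fixes a b :: "'a::real_normed_vector"
  assumes "0 < \<delta>"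
  shows "\<bar>(norm a)\<^sup>2 - (norm b)\<^sup>2\<bar> \<le> (1 + 1 / \<delta>) * (norm (a - b))\<^sup>2 + \<delta> * (norm b)\<^sup>2"
proof -
  let ?u = "norm (a - b)"
  have "\<bar>(norm a)\<^sup>2 - (norm b)\<^sup>2\<bar> = \<bar>norm a - norm b\<bar> * (norm a + norm b)"
    by (simp add: power2_eq_square square_diff_square_factored abs_mult)
  also have "\<dots> \<le> ?u * (?u + 2 * norm b)"
    using norm_triangle_ineq3[of a b] by (intro mult_mono) auto
  also have "2 * (?u * norm b) \<le> 1 / \<delta> * ?u\<^sup>2 + \<delta> * (norm b)\<^sup>2"
  proof -
    have "0 \<le> (?u - \<delta> * norm b)\<^sup>2 / \<delta>" using assms by simp
    also have "\<dots> = 1 / \<delta> * ?u\<^sup>2 + \<delta> * (norm b)\<^sup>2 - 2 * (?u * norm b)"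
      using assms by (simp add: power2_eq_square field_simps)
    finally show ?thesis by simp
  qed
  then have "?u * (?u + 2 * norm b) \<le> (1 + 1 / \<delta>) * ?u\<^sup>2 + \<delta> * (norm b)\<^sup>2"
    by (simp add: power2_eq_square algebra_simps)
  finally show ?thesis .
qed

lemma square_integrable_diff:
  assumes "square_integrable f" "square_integrable g"
  shows "square_integrable (\<lambda>x. f x - g x)"
proof -
  have [measurable]: "f \<in> borel_measurable borel" "g \<in> borel_measurable borel"
    using assms by (auto simp: square_integrable_def)
  have "integrable lborel (\<lambda>x. (norm (f x - g x))\<^sup>2)"
  proof (rule Bochner_Integration.integrable_bound)
    show "integrable lborel (\<lambda>x. 2 * (norm (f x))\<^sup>2 + 2 * (norm (g x))\<^sup>2)"
      using assms by (simp add: square_integrable_def)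
    have "(norm (f x - g x))\<^sup>2 \<le> 2 * (norm (f x))\<^sup>2 + 2 * (norm (g x))\<^sup>2" for x
    proof -
      have "(norm (f x - g x))\<^sup>2 \<le> (norm (f x) + norm (g x))\<^sup>2"
        by (intro power_mono norm_triangle_ineq4 norm_ge_zero)
      also have "\<dots> \<le> 2 * (norm (f x))\<^sup>2 + 2 * (norm (g x))\<^sup>2"
        using sum_squares_bound[of "norm (f x)" "norm (g x)"] by (simp add: power2_sum)
      finally show ?thesis .
    qed
    then show "AE x in lborel. norm ((norm (f x - g x))\<^sup>2)
        \<le> norm (2 * (norm (f x))\<^sup>2 + 2 * (norm (g x))\<^sup>2)" by simp
  qed measurable
  then show ?thesis by (simp add: square_integrable_def)
qed

lemma L2_tendsto_norm:
  assumes F: "\<And>k. square_integrable (F k)" and f: "square_integrable f" and lim: "L2_tendsto F f"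
  shows "(\<lambda>k. \<integral>x. (norm (F k x))\<^sup>2 \<partial>lborel) \<longlonglongrightarrow> (\<integral>x. (norm (f x))\<^sup>2 \<partial>lborel)"
proof -
  let ?N = "\<integral>x. (norm (f x))\<^sup>2 \<partial>lborel"
  let ?d = "\<lambda>k. \<integral>x. (norm (F k x - f x))\<^sup>2 \<partial>lborel"
  have iF: "integrable lborel (\<lambda>x. (norm (F k x))\<^sup>2)" for k
    using F by (simp add: square_integrable_def)
  have if': "integrable lborel (\<lambda>x. (norm (f x))\<^sup>2)"
    using f by (simp add: square_integrable_def)
  have id: "integrable lborel (\<lambda>x. (norm (F k x - f x))\<^sup>2)" for k
    using square_integrable_diff[OF F f] by (simp add: square_integrable_def)
  \<comment> \<open>\<open>L2_tendsto\<close> speaks of extended nonnegative integrals; square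
    integrability of the differences turns it into a limit of real numbers.\<close>
  have "(\<lambda>k. ennreal (?d k)) \<longlonglongrightarrow> ennreal 0"
    using lim unfolding L2_tendsto_def by (simp add: nn_integral_eq_integral[OF id])
  then have d: "?d \<longlonglongrightarrow> 0"
    by (subst (asm) tendsto_ennreal_iff) (auto simp: integral_nonneg_AE)
  have bound: "\<bar>(\<integral>x. (norm (F k x))\<^sup>2 \<partial>lborel) - ?N\<bar> \<le> (1 + 1 / \<delta>) * ?d k + \<delta> * ?N"
    if "0 < \<delta>" for k \<delta>
  proof -
    have "\<bar>(\<integral>x. (norm (F k x))\<^sup>2 \<partial>lborel) - ?N\<bar> = \<bar>\<integral>x. (norm (F k x))\<^sup>2 - (norm (f x))\<^sup>2 \<partial>lborel\<bar>"
      using iF if' by simp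
    also have "\<dots> \<le> (\<integral>x. \<bar>(norm (F k x))\<^sup>2 - (norm (f x))\<^sup>2\<bar> \<partial>lborel)"
      by (rule integral_abs_bound)
    also have "\<dots> \<le> (\<integral>x. (1 + 1 / \<delta>) * (norm (F k x - f x))\<^sup>2 + \<delta> * (norm (f x))\<^sup>2 \<partial>lborel)"
      by (intro integral_mono abs_diff_norm_power2_le that integrable_abs
          Bochner_Integration.integrable_diff Bochner_Integration.integrable_add
          integrable_mult_right iF if' id)
    also have "\<dots> = (1 + 1 / \<delta>) * ?d k + \<delta> * ?N"
      using if' id by simp
    finally show ?thesis .
  qed
  define N where "N = ?N"
  have N: "0 \<le> N" by (simp add: N_def integral_nonneg_AE)
  show ?thesis
  proof (rule LIMSEQ_I)
    fix e :: real assume "0 < e"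
    \<comment> \<open>First \<open>\<delta>\<close> makes the term independent of \<open>k\<close>
      small, then \<open>k\<close> is taken large. The \<open>+ 1\<close> keeps the denominator
      positive when \<open>N = 0\<close>.\<close>
    define \<delta> where "\<delta> = e / (2 * (N + 1))"
    have "0 < \<delta>" unfolding \<delta>_def using \<open>0 < e\<close> N by simp
    have "\<delta> * N < e / 2"
      using \<open>0 < e\<close> N unfolding \<delta>_def by (simp add: field_simps)
    have "(\<lambda>k. (1 + 1 / \<delta>) * ?d k) \<longlonglongrightarrow> 0"
      using d by (rule tendsto_mult_right_zero)
    from order_tendstoD(2)[OF this, of "e / 2"] \<open>0 < e\<close>
    obtain K where K: "\<And>k. K \<le> k \<Longrightarrow> (1 + 1 / \<delta>) * ?d k < e / 2"
      unfolding eventually_sequentially by auto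
    have "norm ((\<integral>x. (norm (F k x))\<^sup>2 \<partial>lborel) - ?N) < e" if "K \<le> k" for k
    proof -
      have "norm ((\<integral>x. (norm (F k x))\<^sup>2 \<partial>lborel) - ?N) \<le> (1 + 1 / \<delta>) * ?d k + \<delta> * N"
        using bound[OF \<open>0 < \<delta>\<close>, of k] unfolding real_norm_def N_def .
      also have "\<dots> < e / 2 + e / 2"
        by (rule add_strict_mono[OF K[OF that] \<open>\<delta> * N < e / 2\<close>])
      finally show ?thesis by simp
    qed
    then show "\<exists>K. \<forall>k\<ge>K. norm ((\<integral>x. (norm (F k x))\<^sup>2 \<partial>lborel) - ?N) < e" by blast
  qed
qed

text \<open>Both sides are continuous under \<open>L^2\<close> convergence, so the identity passes
  from the approximants in the definition of \<open>has_L2_fourier\<close> to the pair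
  \<open>f\<close>, \<open>g\<close>.\<close>

theorem plancherel:
  assumes "has_L2_fourier f g"
  shows "(\<integral>\<omega>. (norm (g \<omega>))\<^sup>2 \<partial>lborel) = 2 * pi * (\<integral>x. (norm (f x))\<^sup>2 \<partial>lborel)"
proof -
  from assms obtain F where f: "square_integrable f" and g: "square_integrable g"
    and F: "\<And>k. integrable lborel (F k)" "\<And>k. square_integrable (F k)"
    and lim: "L2_tendsto F f" "L2_tendsto (\<lambda>k. fourier (F k)) g"
    unfolding has_L2_fourier_def by blast
  note PL = plancherel_L1_L2[OF F]
  have meas: "fourier (F k) \<in> borel_measurable borel" for k
    using F(1)[of k] by (intro fourier_measurable) auto
  \<comment> \<open>Finiteness of the integral is itself part of the Plancherel identity for
    \<open>F k\<close>.\<close>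
  have si: "square_integrable (fourier (F k))" for k
    unfolding square_integrable_def using meas[of k] PL[of k]
    by (auto intro!: integrableI_bounded)
  have eq: "(\<integral>\<omega>. (norm (fourier (F k) \<omega>))\<^sup>2 \<partial>lborel) = 2 * pi * (\<integral>x. (norm (F k x))\<^sup>2 \<partial>lborel)" for k
    using PL[of k] meas[of k] by (subst integral_eq_nn_integral) (auto simp: integral_nonneg_AE)
  have "(\<lambda>k. \<integral>\<omega>. (norm (fourier (F k) \<omega>))\<^sup>2 \<partial>lborel) \<longlonglongrightarrow> (\<integral>\<omega>. (norm (g \<omega>))\<^sup>2 \<partial>lborel)"
    by (rule L2_tendsto_norm[OF si g lim(2)])
  moreover have "(\<lambda>k. \<integral>\<omega>. (norm (fourier (F k) \<omega>))\<^sup>2 \<partial>lborel)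
      \<longlonglongrightarrow> 2 * pi * (\<integral>x. (norm (f x))\<^sup>2 \<partial>lborel)"
    unfolding eq by (intro tendsto_mult_left L2_tendsto_norm[OF F(2) f lim(1)])
  ultimately show ?thesis by (rule LIMSEQ_unique)
qed

section \<open>The norm of Auscher's wavelets\<close>

lemma integral_indicator_annulus:
  fixes a b :: real
  assumes "0 < a" "a \<le> b"
  shows "(\<integral>x. (if a \<le> \<bar>x\<bar> \<and> \<bar>x\<bar> < b then 1 else 0) \<partial>lborel) = 2 * (b - a)"
proof -
  \<comment> \<open>Since \<open>0 < a\<close>, the positive and negative intervals are disjoint, so
    their indicators add without overlap.\<close>
  have "(\<integral>x. (if a \<le> \<bar>x\<bar> \<and> \<bar>x\<bar> < b then 1 else 0) \<partial>lborel)
      = (\<integral>x. indicator {a..<b} x + indicator {-b<..-a} x \<partial>lborel)"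
    using assms by (intro Bochner_Integration.integral_cong) (auto simp: indicator_def)
  also have "\<dots> = 2 * (b - a)" using assms by simp
  finally show ?thesis .
qed

text \<open>The band has measure \<open>2 * pi / p\<close> for every \<open>m\<close>. As it
  prescribes the transform at \<open>?M * \<omega>\<close>, undoing the dilation multiplies by
  \<open>p / q\<close>, and Plancherel divides by \<open>2 * pi\<close>.\<close>

lemma auscher_wavelet_norm:
  assumes W: "auscher_wavelet p q m \<psi>" and "0 < p" "1 \<le> q" "1 \<le> m"
  shows "(\<integral>x. (norm (\<psi> x))\<^sup>2 \<partial>lborel) = 1 / of_int q"
proof -
  let ?M = "real_of_int p / real_of_int q"
  let ?a = "of_int (q + m - 1) * (pi / of_int p)" and ?b = "of_int (q + m) * (pi / of_int p)"
  let ?\<chi> = "\<lambda>\<omega>. if ?a \<le> \<bar>\<omega>\<bar> \<and> \<bar>\<omega>\<bar> < ?b then 1 else 0"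
  from W obtain g where g: "has_L2_fourier \<psi> g" and AE: "AE \<omega> in lborel. g (?M * \<omega>) = ?\<chi> \<omega>"
    unfolding auscher_wavelet_def by auto
  have [measurable]: "g \<in> borel_measurable borel"
    using g by (simp add: has_L2_fourier_def square_integrable_def)
  have "0 < ?M" using assms by simp
  have "2 * pi * (\<integral>x. (norm (\<psi> x))\<^sup>2 \<partial>lborel) = (\<integral>\<omega>. (norm (g \<omega>))\<^sup>2 \<partial>lborel)"
    using plancherel[OF g] by simp
  also have "\<dots> = ?M * (\<integral>\<omega>. (norm (g (?M * \<omega>)))\<^sup>2 \<partial>lborel)"
    using \<open>0 < ?M\<close> assms(2,3) by (subst lborel_integral_real_affine[where c = ?M and t = 0]) auto
  also have "(\<integral>\<omega>. (norm (g (?M * \<omega>)))\<^sup>2 \<partial>lborel) = (\<integral>\<omega>. ?\<chi> \<omega> \<partial>lborel)"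
  proof (rule integral_cong_AE)
    show "AE \<omega> in lborel. (norm (g (?M * \<omega>)))\<^sup>2 = ?\<chi> \<omega>"
      using AE by eventually_elim simp
  qed measurable
  also have "\<dots> = 2 * (?b - ?a)"
    using assms by (intro integral_indicator_annulus) (auto intro!: divide_right_mono mult_right_mono)
  also have "?M * (2 * (?b - ?a)) = 2 * pi * (1 / of_int q)"
    using assms by (simp add: field_simps)
  finally show ?thesis by (subst (asm) mult_cancel_left) simp
qed

theorem theorem1:
  fixes p q :: int and \<psi> :: "int \<Rightarrow> real \<Rightarrow> complex"
  assumes "coprime p q" and "p > q" and "q \<ge> 1"
    and "\<And>m. 1 \<le> m \<Longrightarrow> m \<le> p - q \<Longrightarrow> auscher_wavelet p q m (\<psi> m)"
    and "q \<noteq> 1"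
  shows "\<not> L2_orthonormal (UNIV \<times> UNIV \<times> {1..p - q}) (wavelet_system p q \<psi>)"
proof
  assume "L2_orthonormal (UNIV \<times> UNIV \<times> {1..p - q}) (wavelet_system p q \<psi>)"
  \<comment> \<open>The index \<open>m = 1\<close> is available because
    \<open>p > q\<close>.\<close>
  then have "L2_inner (wavelet_system p q \<psi> (0, 0, 1)) (wavelet_system p q \<psi> (0, 0, 1)) = 1"
    using \<open>p > q\<close> unfolding L2_orthonormal_def by auto
  \<comment> \<open>The prefactor is \<open>M powr 0\<close>, which equals 1 because
    \<open>M\<close> is positive; \<open>0 powr 0\<close> would be 0.\<close>
  moreover have "wavelet_system p q \<psi> (0, 0, 1) = \<psi> 1"
    using assms(2,3) by (auto simp: wavelet_system_def)
  ultimately have "(\<integral>x. complex_of_real ((norm (\<psi> 1 x))\<^sup>2) \<partial>lborel) = 1"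
    by (simp only: L2_inner_def complex_norm_square)
  then have "(\<integral>x. (norm (\<psi> 1 x))\<^sup>2 \<partial>lborel) = 1"
    unfolding integral_complex_of_real by (simp only: of_real_eq_1_iff)
  moreover have "(\<integral>x. (norm (\<psi> 1 x))\<^sup>2 \<partial>lborel) = 1 / of_int q"
    using assms by (intro auscher_wavelet_norm[of p q 1]) auto
  ultimately show False using \<open>q \<noteq> 1\<close> by simp
qed

end
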